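(* Assume that for each $k\in\mathbb Z_N$, $$f_k(x,u)=A_kx+B_ku,\quad L_k(x,u)=\tfrac12\begin{bmatrix}x^{\mathrm T}&u^{\mathrm T}\end{bmatrix}\begin{bmatrix}Q_k&N_k\\N_k^{\mathrm T}&R_k\end{bmatrix}\begin{bmatrix}x\\ u\end{bmatrix},\quad V_f(x)=\tfrac12x^{\mathrm T}P_fx,$$ with $P_f$ positive definite, and assume that the matrices $P_k$ and $R_k+B_k^{\mathrm T}P_{k+1}B_k$ are positive definite for all $k\in\mathbb Z_N$, where $P_N=P_f$ and, for $k\in\mathbb Z_N$, $$\begin{aligned}K_k&=-(R_k+B_k^{\mathrm T}P_{k+1}B_k)^{-1}(B_k^{\mathrm T}P_{k+1}A_k+N_k^{\mathrm T}),\\ P_k&=A_k^{\mathrm T}P_{k+1}A_k+Q_k+(A_k^{\mathrm T}P_{k+1}B_k+N_k)K_k.\end{aligned}$$ Let $\hat A_k=A_k+B_kK_k$. Let the sequence of control inputs $\hat u'=(\hat u'_0,\dots,\hat u'_{N-1})$ solve $$\begin{aligned}\min_{\hat u}\ & \tfrac12\sum_{k=0}^{N-1}\hat u_k^{\mathrm T}(R_k+B_k^{\mathrm T}P_{k+1}B_k)\hat u_k\\ \text{subject to } & x_{k+1}=\hat A_kx_k+B_k\hat u_k\quad\forall k\in\mathbb Z_N,\\ & (x_k,K_kx_k+\hat u_k)\in\mathcal C_k\quad\forall k\in\mathbb Z_N,\\ & x_N\in\mathcal X_N,\end{aligned}$$ with $x_0$ given. Define $\hat x_0'=x_0$ and $\hat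 x_{k+1}'=\hat A_k\hat x_k'+B_k\hat u_k'$ for $k\in\mathbb Z_N$. Then the sequence of control inputs $u'=(u'_0,\dots,u'_{N-1})$ satisfying $$u_k'=K_k\hat x_k'+\hat u_k'\quad\text{for all }k\in\mathbb Z_N$$ solves the optimization problem $$\begin{aligned}\min_{u}\ & V_f(x_N)+\sum_{k=0}^{N-1}L_k(x_k,u_k)\\ \text{subject to } & x_{k+1}=f_k(x_k,u_k)\quad\forall k\in\mathbb Z_N,\\ & (x_k,u_k)\in\mathcal C_k\quad\forall k\in\mathbb Z_N,\\ & x_N\in\mathcal X_N,\end{aligned}$$ with the same given $x_0$.
   Context: $N$ is a positive integer and $\mathbb Z_N=\{0,1,\dots,N-1\}$. The initial state $x_0\in\mathbb R^n$ is given. For each $k\in\mathbb Z_N$, $\mathcal C_k\subset\mathbb R^n\times\mathbb R^m$ is closed; $\mathcal X_N\subset\mathbb R^n$ is the terminal constraint set. The matrices are real with $A_k,Q_k,P_f\in\mathbb R^{n\times n}$, $B_k,N_k\in\mathbb R^{n\times m}$, $R_k\in\mathbb R^{m\times m}$; "positive definite" means symmetric positive definite. The standing assumptions on the costs are $L_k(x,u)\ge\alpha(\|u\|)$ and $V_f(x)\ge0$ for all $x\in\mathbb R^n$, $u\in\mathbb R^m$, $k\in\mathbb Z_N$, where $\alpha$ is a $\mathcal K_\infty$-function (i.e., $\alpha:[0,\infty)\to[0,\infty)$ is continuous, strictly increasing, unbounded, with $\alpha(0)=0$). A sequence of control inputs "solves" an optimization problem if it, together with the state trajectory it generates from $x_0$,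 satisfies the constraints and attains the minimum of the cost over all such sequences. *)

theory Defs
  imports "HOL-Analysis.Analysis"
begin

definition K_infinity :: "(real \<Rightarrow> real) \<Rightarrow> bool" where
  "K_infinity \<alpha> \<longleftrightarrow>
     \<alpha> ` {0..} \<subseteq> {0..} \<and> continuous_on {0..} \<alpha> \<and> strict_mono_on {0..} \<alpha> \<and>
     \<not> bounded (\<alpha> ` {0..}) \<and> \<alpha> 0 = 0"

definition pos_def :: "real^'n^'n \<Rightarrow> bool" where
  "pos_def M \<longleftrightarrow> transpose M = M \<and> (\<forall>x. x \<noteq> 0 \<longrightarrow> x \<bullet> (M *v x) > 0)"

definition block_vec :: "real^'n \<Rightarrow> real^'m \<Rightarrow> real^('n + 'm)" where
  "block_vec x u = (\<chi> i. case i of Inl a \<Rightarrow> x $ a | Inr b \<Rightarrow> u $ b)"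

text \<open>The block matrix with first block row \<open>E F\<close> and second block row \<open>G H\<close>.\<close>

definition block_mat ::
  "real^'n^'n \<Rightarrow> real^'m^'n \<Rightarrow> real^'n^'m \<Rightarrow> real^'m^'m \<Rightarrow> real^('n + 'm)^('n + 'm)" where
  "block_mat E F G H =
     (\<chi> i j. case i of
        Inl a \<Rightarrow> (case j of Inl c \<Rightarrow> E $ a $ c | Inr d \<Rightarrow> F $ a $ d)
      | Inr b \<Rightarrow> (case j of Inl c \<Rightarrow> G $ b $ c | Inr d \<Rightarrow> H $ b $ d))"

text \<open>
  Finite-horizon optimal control problems with horizon \<open>N\<close>, dynamics \<open>f\<close>, stage cost \<open>L\<close>,
  terminal cost \<open>V\<close>, mixed stage constraints \<open>C\<close> and terminal constraint set \<open>X\<close>.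
  An input sequence of length \<open>N\<close> is represented by a function on \<^typ>\<open>nat\<close>; only its values
  at \<open>k < N\<close> influence feasibility and cost.
\<close>

fun trajectory :: "(nat \<Rightarrow> 'x \<Rightarrow> 'u \<Rightarrow> 'x) \<Rightarrow> 'x \<Rightarrow> (nat \<Rightarrow> 'u) \<Rightarrow> nat \<Rightarrow> 'x" where
  "trajectory f x0 u 0 = x0"
| "trajectory f x0 u (Suc k) = f k (trajectory f x0 u k) (u k)"

definition feasible ::
  "nat \<Rightarrow> (nat \<Rightarrow> 'x \<Rightarrow> 'u \<Rightarrow> 'x) \<Rightarrow> (nat \<Rightarrow> ('x \<times> 'u) set) \<Rightarrow> 'x set \<Rightarrow> 'x \<Rightarrow> (nat \<Rightarrow> 'u) \<Rightarrow> bool" where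
  "feasible N f C X x0 u \<longleftrightarrow>
     (\<forall>k<N. (trajectory f x0 u k, u k) \<in> C k) \<and> trajectory f x0 u N \<in> X"

definition total_cost ::
  "nat \<Rightarrow> (nat \<Rightarrow> 'x \<Rightarrow> 'u \<Rightarrow> 'x) \<Rightarrow> (nat \<Rightarrow> 'x \<Rightarrow> 'u \<Rightarrow> real) \<Rightarrow> ('x \<Rightarrow> real) \<Rightarrow>
   'x \<Rightarrow> (nat \<Rightarrow> 'u) \<Rightarrow> real" where
  "total_cost N f L V x0 u =
     V (trajectory f x0 u N) + (\<Sum>k<N. L k (trajectory f x0 u k) (u k))"

definition solves ::
  "nat \<Rightarrow> (nat \<Rightarrow> 'x \<Rightarrow> 'u \<Rightarrow> 'x) \<Rightarrow> (nat \<Rightarrow> 'x \<Rightarrow> 'u \<Rightarrow> real) \<Rightarrow> ('x \<Rightarrow> real) \<Rightarrow>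
   (nat \<Rightarrow> ('x \<times> 'u) set) \<Rightarrow> 'x set \<Rightarrow> 'x \<Rightarrow> (nat \<Rightarrow> 'u) \<Rightarrow> bool" where
  "solves N f L V C X x0 u \<longleftrightarrow>
     feasible N f C X x0 u \<and>
     (\<forall>v. feasible N f C X x0 v \<longrightarrow> total_cost N f L V x0 u \<le> total_cost N f L V x0 v)"

end

theory Submission
  imports Defs
begin

text \<open>
  The proof is a completion of the square. Write \<open>S\<^sub>k = R\<^sub>k + B\<^sub>k\<^sup>T P\<^sub>k\<^sub>+\<^sub>1 B\<^sub>k\<close> and \<open>W\<^sub>k(x) = x\<^sup>T P\<^sub>k x / 2\<close>.
  The gain \<open>K\<^sub>k\<close> is the minimiser in \<open>u\<close> of the quadratic function
  \<open>L\<^sub>k(x, u) + W\<^sub>k\<^sub>+\<^sub>1(A\<^sub>k x + B\<^sub>k u)\<close>, and the Riccati recursion says that its minimal value is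
  \<open>W\<^sub>k(x)\<close>. Expanding around the minimiser therefore gives, for every deviation \<open>v\<close>,
  \<open>L\<^sub>k(x, K\<^sub>k x + v) + W\<^sub>k\<^sub>+\<^sub>1(x\<^sup>+) = W\<^sub>k(x) + v\<^sup>T S\<^sub>k v / 2\<close>, where \<open>x\<^sup>+\<close> is the successor state
  (\<open>riccati_completion_of_squares\<close>).

  Summed along a trajectory the terms \<open>W\<^sub>k\<close> telescope, so the original cost of \<open>u\<close> and the
  quadratic cost of \<open>v\<^sub>k = u\<^sub>k - K\<^sub>k x\<^sub>k\<close> differ by \<open>W\<^sub>0(x\<^sub>0)\<close>, a constant because the initial state is
  given. The substitution \<open>u \<leftrightarrow> v\<close> is a bijection that leaves the state trajectory unchanged and
  matches the constraints, so minimisers correspond to minimisers. This half of the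
  argument is stated for an arbitrary feedback law and storage function (\<open>solves_by_feedback_transformation\<close>).
\<close>

section \<open>Feedback transformations of optimal control problems\<close>

lemma trajectory_unique:
  assumes "y 0 = x0" and "\<And>k. k < N \<Longrightarrow> y (Suc k) = f k (y k) (u k)" and "j \<le> N"
  shows "trajectory f x0 u j = y j"
  using \<open>j \<le> N\<close> by (induction j) (simp_all add: assms(1,2))

lemma feasible_feedback_iff:
  assumes "\<And>k. k \<le> N \<Longrightarrow> trajectory g x0 v k = trajectory f x0 u k"
    and "\<And>k. k < N \<Longrightarrow> u k = \<kappa> k (trajectory f x0 u k) + v k"
  shows "feasible N g (\<lambda>k. {(x, v). (x, \<kappa> k x + v) \<in> C k}) X x0 v \<longleftrightarrow> feasible N f C X x0 u"
  using assms by (auto simp: feasible_def)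

text \<open>
  The dissipation equality telescopes along the common trajectory, leaving only \<open>W 0\<close> at the
  initial state and \<open>W N\<close>, which is the terminal cost.
\<close>
lemma total_cost_feedback:
  fixes W :: "nat \<Rightarrow> 'x \<Rightarrow> real"
  assumes traj: "\<And>k. k \<le> N \<Longrightarrow> trajectory g x0 v k = trajectory f x0 u k"
    and input: "\<And>k. k < N \<Longrightarrow> u k = \<kappa> k (trajectory f x0 u k) + v k"
    and diss: "\<And>k x v. k < N \<Longrightarrow>
      L k x (\<kappa> k x + v) + W (Suc k) (f k x (\<kappa> k x + v)) = W k x + M k x v"
    and V: "\<And>x. V x = W N x"
  shows "total_cost N f L V x0 u = W 0 x0 + total_cost N g M (\<lambda>x. 0) x0 v"
proof -
  let ?x = "trajectory f x0 u"
  have "(\<Sum>k<N. L k (?x k) (u k)) = (\<Sum>k<N. (W k (?x k) - W (Suc k) (?x (Suc k))) + M k (?x k) (v k))"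
  proof (rule sum.cong)
    fix k assume "k \<in> {..<N}"
    then have "k < N" by simp
    show "L k (?x k) (u k) = (W k (?x k) - W (Suc k) (?x (Suc k))) + M k (?x k) (v k)"
      using diss[OF \<open>k < N\<close>, of "?x k" "v k"] input[OF \<open>k < N\<close>, symmetric] by simp
  qed simp
  also have "\<dots> = W 0 x0 - W N (?x N) + (\<Sum>k<N. M k (?x k) (v k))"
    using sum_lessThan_telescope'[of "\<lambda>k. W k (?x k)" N]
    by (simp add: sum.distrib del: trajectory.simps(2))
  also have "(\<Sum>k<N. M k (?x k) (v k)) = (\<Sum>k<N. M k (trajectory g x0 v k) (v k))"
    by (simp add: traj)
  finally show ?thesis
    by (simp add: total_cost_def V)
qed

text \<open>
  Adding the feedback \<open>\<kappa>\<close> is invertible along trajectories, so every competitor of \<open>u\<close> in the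
  original problem yields a competitor of \<open>v\<close> in the transformed one, and the two costs differ by
  \<open>W 0 x0\<close> whatever the competitor.
\<close>
lemma solves_by_feedback_transformation:
  fixes W :: "nat \<Rightarrow> 'x \<Rightarrow> real" and \<kappa> :: "nat \<Rightarrow> 'x \<Rightarrow> 'u::ab_group_add"
  assumes sol: "solves N g M (\<lambda>x. 0) (\<lambda>k. {(x, v). (x, \<kappa> k x + v) \<in> C k}) X x0 v"
    and dyn: "\<And>k x v. k < N \<Longrightarrow> g k x v = f k x (\<kappa> k x + v)"
    and diss: "\<And>k x v. k < N \<Longrightarrow>
      L k x (\<kappa> k x + v) + W (Suc k) (f k x (\<kappa> k x + v)) = W k x + M k x v"
    and V: "\<And>x. V x = W N x"
    and input: "\<And>k. k < N \<Longrightarrow> u k = \<kappa> k (trajectory g x0 v k) + v k"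
  shows "solves N f L V C X x0 u"
  unfolding solves_def
proof (intro conjI allI impI)
  have traj: "trajectory g x0 v k = trajectory f x0 u k" if "k \<le> N" for k
    by (rule trajectory_unique[symmetric, OF _ _ that]) (simp_all add: dyn input)
  have input': "u k = \<kappa> k (trajectory f x0 u k) + v k" if "k < N" for k
    using input[OF that] traj[of k] that by simp
  show "feasible N f C X x0 u"
    using sol feasible_feedback_iff[where \<kappa> = \<kappa>, OF traj input'] by (simp add: solves_def)
  fix w assume w: "feasible N f C X x0 w"
  define v' where "v' k = w k - \<kappa> k (trajectory f x0 w k)" for k
  have w_input: "w k = \<kappa> k (trajectory f x0 w k) + v' k" for k
    by (simp add: v'_def)
  have w_traj: "trajectory g x0 v' k = trajectory f x0 w k" if "k \<le> N" for k
    by (rule trajectory_unique[OF _ _ that]) (simp_all add: dyn v'_def)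
  have "feasible N g (\<lambda>k. {(x, v). (x, \<kappa> k x + v) \<in> C k}) X x0 v'"
    using w feasible_feedback_iff[where \<kappa> = \<kappa>, OF w_traj w_input] by simp
  then have "total_cost N g M (\<lambda>x. 0) x0 v \<le> total_cost N g M (\<lambda>x. 0) x0 v'"
    using sol by (simp add: solves_def)
  then show "total_cost N f L V x0 u \<le> total_cost N f L V x0 w"
    using total_cost_feedback[where \<kappa> = \<kappa>, OF traj input' diss V]
      total_cost_feedback[where \<kappa> = \<kappa>, OF w_traj w_input diss V]
    by simp
qed

section \<open>Quadratic forms\<close>

lemma sum_over_sum_type:
  fixes h :: "'a::finite + 'b::finite \<Rightarrow> 'c::comm_monoid_add"
  shows "(\<Sum>i\<in>UNIV. h i) = (\<Sum>a\<in>UNIV. h (Inl a)) + (\<Sum>b\<in>UNIV. h (Inr b))"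
  by (simp add: UNIV_Plus_UNIV[symmetric] sum.Plus del: UNIV_Plus_UNIV)

lemma block_mat_mult_block_vec:
  "block_mat E F G H *v block_vec x u = block_vec (E *v x + F *v u) (G *v x + H *v u)"
  by (simp add: vec_eq_iff block_mat_def block_vec_def matrix_vector_mult_def sum_over_sum_type
      split: sum.split)

lemma inner_block_vec: "block_vec x u \<bullet> block_vec y w = x \<bullet> y + u \<bullet> w"
  by (simp add: block_vec_def inner_vec_def sum_over_sum_type)

lemma inner_transpose_mult:
  fixes M :: "real^'m^'n"
  shows "u \<bullet> (transpose M *v x) = (M *v u) \<bullet> x"
  by (metis dot_lmul_matrix inner_commute transpose_matrix_vector)

lemma pos_def_inner_commute:
  assumes "pos_def M"
  shows "x \<bullet> (M *v y) = y \<bullet> (M *v x)"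
  using assms inner_transpose_mult[of x M y] by (simp add: pos_def_def inner_commute)

lemma pos_def_mult_matrix_inv:
  fixes M :: "real^'n^'n"
  assumes "pos_def M"
  shows "M ** matrix_inv M = mat 1"
proof -
  have "x = 0" if "M *v x = 0" for x
    using assms that by (metis inner_zero_right less_irrefl pos_def_def)
  then have "invertible M"
    by (metis invertible_left_inverse matrix_left_invertible_ker)
  then show ?thesis
    unfolding matrix_inv_def invertible_def by (rule someI2_ex) blast
qed

section \<open>The Riccati recursion completes the square\<close>

text \<open>
  With \<open>S = R + B\<^sup>T P B\<close> and \<open>G = B\<^sup>T P A + Nm\<^sup>T\<close>, the left-hand side is one half of
  \<open>x\<^sup>T (Q + A\<^sup>T P A) x + 2 u\<^sup>T G x + u\<^sup>T S u\<close> at \<open>u = K x + v\<close>. The gain satisfies \<open>S K = -G\<close>, which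
  makes the terms linear in \<open>v\<close> cancel and turns \<open>2 (K x)\<^sup>T G x + (K x)\<^sup>T S (K x)\<close> into
  \<open>(K x)\<^sup>T G x\<close>, the last term of the Riccati recursion.
\<close>
lemma riccati_completion_of_squares:
  fixes A Q P :: "real^'n^'n" and B Nm :: "real^'m^'n" and R :: "real^'m^'m" and K :: "real^'n^'m"
  assumes P: "pos_def P" and S: "pos_def (R + transpose B ** P ** B)"
    and K: "K = - (matrix_inv (R + transpose B ** P ** B)
                    ** (transpose B ** P ** A + transpose Nm))"
  shows "1/2 * (block_vec x (K *v x + v) \<bullet>
             (block_mat Q Nm (transpose Nm) R *v block_vec x (K *v x + v)))
         + 1/2 * ((A *v x + B *v (K *v x + v)) \<bullet> (P *v (A *v x + B *v (K *v x + v))))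
       = 1/2 * (x \<bullet> ((transpose A ** P ** A + Q + (transpose A ** P ** B + Nm) ** K) *v x))
         + 1/2 * (v \<bullet> ((R + transpose B ** P ** B) *v v))"
proof -
  define S where "S = R + transpose B ** P ** B"
  define G where "G = transpose B ** P ** A + transpose Nm"
  define a where "a = A *v x"
  define k where "k = K *v x"
  define u where "u = k + v"
  note vec = matrix_vector_mult_add_rdistrib matrix_vector_right_distrib
    matrix_vector_mul_assoc[symmetric] inner_transpose_mult inner_add_left inner_add_right
  have neg_mult: "(- M) *v y = - (M *v y)" for M :: "real^'n^'m" and y
    by (simp add: vec_eq_iff matrix_vector_mult_def sum_negf)
  have mult_neg: "S *v (- y) = - (S *v y)" for y
    by (simp add: vec_eq_iff matrix_vector_mult_def sum_negf)
  have "S *v k = - ((S ** matrix_inv S) *v (G *v x))"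
    unfolding k_def K S_def[symmetric] G_def[symmetric]
    by (simp add: neg_mult mult_neg flip: matrix_vector_mul_assoc)
  then have Gx: "G *v x = - (S *v k)"
    using pos_def_mult_matrix_inv[OF S] by (simp add: S_def)
  note [simp del] = transpose_matrix_vector
  have uG: "w \<bullet> (G *v x) = (B *v w) \<bullet> (P *v a) + x \<bullet> (Nm *v w)" for w
    unfolding G_def a_def by (simp add: vec inner_commute[of x])
  have uS: "w \<bullet> (S *v w) = w \<bullet> (R *v w) + (B *v w) \<bullet> (P *v (B *v w))" for w
    unfolding S_def by (simp add: vec)
  have xu: "block_vec x u \<bullet> (block_mat Q Nm (transpose Nm) R *v block_vec x u)
      = x \<bullet> (Q *v x) + 2 * (x \<bullet> (Nm *v u)) + u \<bullet> (R *v u)"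
    by (simp add: block_mat_mult_block_vec inner_block_vec vec inner_commute[of x])
  have succ: "(a + B *v u) \<bullet> (P *v (a + B *v u))
      = a \<bullet> (P *v a) + 2 * ((B *v u) \<bullet> (P *v a)) + (B *v u) \<bullet> (P *v (B *v u))"
    using pos_def_inner_commute[OF P, of a "B *v u"] by (simp add: vec)
  have "x \<bullet> ((transpose A ** P ** B + Nm) *v k) = k \<bullet> (G *v x)"
    using uG[of k] pos_def_inner_commute[OF P, of a "B *v k"]
    by (simp add: vec a_def)
  then have val: "x \<bullet> ((transpose A ** P ** A + Q + (transpose A ** P ** B + Nm) ** K) *v x)
      = a \<bullet> (P *v a) + x \<bullet> (Q *v x) + k \<bullet> (G *v x)"
    by (simp add: vec a_def k_def)
  have "2 * (u \<bullet> (G *v x)) + u \<bullet> (S *v u) = k \<bullet> (G *v x) + v \<bullet> (S *v v)"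
    using pos_def_inner_commute[OF S, folded S_def, of k v]
    by (simp add: Gx u_def matrix_vector_right_distrib inner_add_left inner_add_right)
  then show ?thesis
    unfolding k_def[symmetric] a_def[symmetric] u_def[symmetric] S_def[symmetric] xu succ val
    using uG[of u] uS[of u] by argo
qed

section \<open>Equivalence of the two problems\<close>

theorem corollary3:
  fixes N :: nat
    and x0 :: "real^'n"
    and \<C> :: "nat \<Rightarrow> ((real^'n) \<times> (real^'m)) set"
    and \<X> :: "(real^'n) set"
    and f :: "nat \<Rightarrow> real^'n \<Rightarrow> real^'m \<Rightarrow> real^'n"
    and L :: "nat \<Rightarrow> real^'n \<Rightarrow> real^'m \<Rightarrow> real"
    and Vf :: "real^'n \<Rightarrow> real"
    and \<alpha> :: "real \<Rightarrow> real"
    and A Q P Ahat :: "nat \<Rightarrow> real^'n^'n"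
    and Pf :: "real^'n^'n"
    and B Nm :: "nat \<Rightarrow> real^'m^'n"
    and R :: "nat \<Rightarrow> real^'m^'m"
    and K :: "nat \<Rightarrow> real^'n^'m"
    and uhat u :: "nat \<Rightarrow> real^'m"
    and xhat :: "nat \<Rightarrow> real^'n"
  assumes "N > 0"
    and "\<And>k. k < N \<Longrightarrow> closed (\<C> k)"
    and "K_infinity \<alpha>"
    and "\<And>k x u. k < N \<Longrightarrow> L k x u \<ge> \<alpha> (norm u)"
    and "\<And>x. Vf x \<ge> 0"
    and "\<And>k x u. k < N \<Longrightarrow> f k x u = A k *v x + B k *v u"
    and "\<And>k x u. k < N \<Longrightarrow>
           L k x u = 1/2 * (block_vec x u \<bullet>
             (block_mat (Q k) (Nm k) (transpose (Nm k)) (R k) *v block_vec x u))"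
    and "\<And>x. Vf x = 1/2 * (x \<bullet> (Pf *v x))"
    and "pos_def Pf"
    and "P N = Pf"
    and "\<And>k. k < N \<Longrightarrow>
           K k = - (matrix_inv (R k + transpose (B k) ** P (k+1) ** B k)
                    ** (transpose (B k) ** P (k+1) ** A k + transpose (Nm k)))"
    and "\<And>k. k < N \<Longrightarrow>
           P k = transpose (A k) ** P (k+1) ** A k + Q k
                 + (transpose (A k) ** P (k+1) ** B k + Nm k) ** K k"
    and "\<And>k. k < N \<Longrightarrow> pos_def (P k)"
    and "\<And>k. k < N \<Longrightarrow> pos_def (R k + transpose (B k) ** P (k+1) ** B k)"
    and "\<And>k. k < N \<Longrightarrow> Ahat k = A k + B k ** K k"
    and "solves N
           (\<lambda>k x v. Ahat k *v x + B k *v v)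
           (\<lambda>k x v. 1/2 * (v \<bullet> ((R k + transpose (B k) ** P (k+1) ** B k) *v v)))
           (\<lambda>x. 0)
           (\<lambda>k. {(x, v). (x, K k *v x + v) \<in> \<C> k})
           \<X> x0 uhat"
    and "xhat 0 = x0"
    and "\<And>k. k < N \<Longrightarrow> xhat (k+1) = Ahat k *v xhat k + B k *v uhat k"
    and "\<And>k. k < N \<Longrightarrow> u k = K k *v xhat k + uhat k"
  shows "solves N f L Vf \<C> \<X> x0 u"
proof (rule solves_by_feedback_transformation[where \<kappa> = "\<lambda>k x. K k *v x"
      and W = "\<lambda>k x. 1/2 * (x \<bullet> (P k *v x))", OF assms(16)])
  fix k x v assume k: "k < N"
  show "Ahat k *v x + B k *v v = f k x (K k *v x + v)"
    by (simp add: assms(6,15)[OF k] matrix_vector_mult_add_rdistrib matrix_vector_right_distrib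
        matrix_vector_mul_assoc add.assoc)
next
  fix k x v assume k: "k < N"
  have "pos_def (P (k + 1))"
    using assms(9,10) assms(13)[of "k + 1"] k by (cases "k + 1 = N") auto
  from riccati_completion_of_squares[OF this assms(14,11)[OF k]]
  show "L k x (K k *v x + v) + 1/2 * (f k x (K k *v x + v) \<bullet> (P (Suc k) *v f k x (K k *v x + v)))
      = 1/2 * (x \<bullet> (P k *v x)) + 1/2 * (v \<bullet> ((R k + transpose (B k) ** P (k + 1) ** B k) *v v))"
    by (simp only: assms(6,7,12)[OF k] Suc_eq_plus1)
next
  show "Vf x = 1/2 * (x \<bullet> (P N *v x))" for x
    by (simp only: assms(8,10))
next
  fix k assume k: "k < N"
  have "trajectory (\<lambda>k x v. Ahat k *v x + B k *v v) x0 uhat k = xhat k"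
    by (rule trajectory_unique[where N = N]) (use assms(17,18) k in auto)
  then show "u k = K k *v trajectory (\<lambda>k x v. Ahat k *v x + B k *v v) x0 uhat k + uhat k"
    by (simp add: assms(19)[OF k])
qed

end
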